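(* Consider network contribution games with reward functions $f_e(x,y)=h_e(\max(x,y))$ for all $e\in E$, where the $h_e$ are arbitrary (continuous) monotonic increasing functions. A pairwise equilibrium always exists in such games, and the price of stability for pairwise equilibria is $1$.
   Context: Network contribution game: a finite simple undirected graph $G=(V,E)$; every node $v\in V$ is a player with budget $B_v\ge 0$. Let $E_v$ be the set of edges incident to $v$. A strategy of $v$ is a function $s_v:E_v\to\mathbb{R}_{\ge 0}$ with $\sum_{e\in E_v}s_v(e)\le B_v$; a state $s=(s_v)_{v\in V}$ consists of one strategy per player. Each edge $e=(u,v)$ has a continuous reward function $f_e:\mathbb{R}_{\ge 0}^2\to\mathbb{R}_{\ge 0}$; here $f_e(x,y)=h_e(\max(x,y))$ with $h_e:\mathbb{R}_{\ge0}\to\mathbb{R}_{\ge0}$. The utility of $v$ is $w_v(s)=\sum_{e=(v,u)\in E_v}f_e(s_v(e),s_u(e))$, and the social welfare is $w(s)=\sum_{v\in V}w_v(s)$. A social optimum $s^*$ is a state maximizing $w$. A state $s$ is a (pure) Nash equilibrium if $w_v(s)\ge w_v(s_v',s_{-v})$ for every player $v$ and every strategy $s_v'$. An improving bilateral deviation in $s$ is a pair of strategies $(s_u',s_v')$ of two players $u\neq v$ with $w_u(s_u',s_v',s_{-u,v})>w_u(s)$ and $w_v(s_u',s_v',s_{-u,v})>w_v(s)$. A pairwise equilibrium is a Nash equilibrium that admits no improving bilateral deviation. The price of stability for pairwise equilibria of a game is the ratio $w(s^* )/w(s)$ for the best pairwise equilibrium $s$ (the one of largest welfare); for a class of games it is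 the worst (supremum) value over all games in the class. *)

theory Defs
  imports "HOL-Analysis.Analysis"
begin

text \<open>Edges of the graph are two-element vertex sets.  The reward function of an edge takes the
  contributions of its two endpoints; the utility of a player passes the own contribution first.\<close>

record 'v contribution_game =
  players :: "'v set"
  edges :: "'v set set"
  budget :: "'v \<Rightarrow> real"
  reward :: "'v set \<Rightarrow> real \<Rightarrow> real \<Rightarrow> real"

definition network_contribution_game :: "'v contribution_game \<Rightarrow> bool" where
  "network_contribution_game G \<longleftrightarrow>
     finite (players G) \<and>
     edges G \<subseteq> {e. e \<subseteq> players G \<and> card e = 2} \<and>
     (\<forall>v\<in>players G. 0 \<le> budget G v) \<and>
     (\<forall>e\<in>edges G.
        continuous_on ({0..} \<times> {0..}) (\<lambda>(x, y). reward G e x y) \<and>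
        (\<forall>x\<ge>0. \<forall>y\<ge>0. 0 \<le> reward G e x y))"

definition max_effort_game :: "'v contribution_game \<Rightarrow> bool" where
  "max_effort_game G \<longleftrightarrow>
     network_contribution_game G \<and>
     (\<exists>h :: 'v set \<Rightarrow> real \<Rightarrow> real. \<forall>e\<in>edges G.
        continuous_on {0..} (h e) \<and> mono_on {0..} (h e) \<and> (\<forall>x\<ge>0. 0 \<le> h e x) \<and>
        (\<forall>x\<ge>0. \<forall>y\<ge>0. reward G e x y = h e (max x y)))"

definition incident_edges :: "'v contribution_game \<Rightarrow> 'v \<Rightarrow> 'v set set" where
  "incident_edges G v = {e \<in> edges G. v \<in> e}"

definition strategies :: "'v contribution_game \<Rightarrow> 'v \<Rightarrow> ('v set \<Rightarrow> real) set" where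
  "strategies G v =
     {x \<in> incident_edges G v \<rightarrow>\<^sub>E {0..}. (\<Sum>e\<in>incident_edges G v. x e) \<le> budget G v}"

definition states :: "'v contribution_game \<Rightarrow> ('v \<Rightarrow> 'v set \<Rightarrow> real) set" where
  "states G = (\<Pi>\<^sub>E v\<in>players G. strategies G v)"

text \<open>The sum over the incident edges of \<open>v\<close> is indexed by the other endpoint \<open>u\<close>.\<close>

definition utility :: "'v contribution_game \<Rightarrow> ('v \<Rightarrow> 'v set \<Rightarrow> real) \<Rightarrow> 'v \<Rightarrow> real" where
  "utility G s v =
     (\<Sum>u | {v, u} \<in> edges G. reward G {v, u} (s v {v, u}) (s u {v, u}))"

definition welfare :: "'v contribution_game \<Rightarrow> ('v \<Rightarrow> 'v set \<Rightarrow> real) \<Rightarrow> real" where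
  "welfare G s = (\<Sum>v\<in>players G. utility G s v)"

definition social_optimum :: "'v contribution_game \<Rightarrow> ('v \<Rightarrow> 'v set \<Rightarrow> real) \<Rightarrow> bool" where
  "social_optimum G s \<longleftrightarrow> s \<in> states G \<and> (\<forall>t\<in>states G. welfare G t \<le> welfare G s)"

definition nash_equilibrium :: "'v contribution_game \<Rightarrow> ('v \<Rightarrow> 'v set \<Rightarrow> real) \<Rightarrow> bool" where
  "nash_equilibrium G s \<longleftrightarrow>
     s \<in> states G \<and>
     (\<forall>v\<in>players G. \<forall>x\<in>strategies G v. utility G (s(v := x)) v \<le> utility G s v)"

definition improving_bilateral_deviation ::
  "'v contribution_game \<Rightarrow> ('v \<Rightarrow> 'v set \<Rightarrow> real) \<Rightarrow>
     'v \<Rightarrow> 'v \<Rightarrow> ('v set \<Rightarrow> real) \<Rightarrow> ('v set \<Rightarrow> real) \<Rightarrow> bool" where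
  "improving_bilateral_deviation G s u v x y \<longleftrightarrow>
     u \<in> players G \<and> v \<in> players G \<and> u \<noteq> v \<and> x \<in> strategies G u \<and> y \<in> strategies G v \<and>
     utility G (s(u := x, v := y)) u > utility G s u \<and>
     utility G (s(u := x, v := y)) v > utility G s v"

definition pairwise_equilibrium :: "'v contribution_game \<Rightarrow> ('v \<Rightarrow> 'v set \<Rightarrow> real) \<Rightarrow> bool" where
  "pairwise_equilibrium G s \<longleftrightarrow>
     nash_equilibrium G s \<and> \<not> (\<exists>u v x y. improving_bilateral_deviation G s u v x y)"

definition best_pairwise_equilibrium ::
  "'v contribution_game \<Rightarrow> ('v \<Rightarrow> 'v set \<Rightarrow> real) \<Rightarrow> bool" where
  "best_pairwise_equilibrium G s \<longleftrightarrow>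
     pairwise_equilibrium G s \<and> (\<forall>t. pairwise_equilibrium G t \<longrightarrow> welfare G t \<le> welfare G s)"

text \<open>Ratios are extended reals: \<open>a / 0 = \<infinity>\<close> for \<open>a > 0\<close>, whereas \<open>0 / 0\<close>, which arises only
  when the optimum itself has welfare \<open>0\<close>, counts as \<open>1\<close> (the library value would be \<open>0\<close>).\<close>

definition welfare_ratio :: "real \<Rightarrow> real \<Rightarrow> ereal" where
  "welfare_ratio a b = (if a = 0 \<and> b = 0 then 1 else ereal a / ereal b)"

text \<open>A relation rather than a function: a game without a social optimum or without a best
  pairwise equilibrium has no price of stability.\<close>

definition has_price_of_stability :: "'v contribution_game \<Rightarrow> ereal \<Rightarrow> bool" where
  "has_price_of_stability G r \<longleftrightarrow>
     (\<exists>s_opt s. social_optimum G s_opt \<and> best_pairwise_equilibrium G s \<and>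
        r = welfare_ratio (welfare G s_opt) (welfare G s))"

definition class_price_of_stability :: "'v contribution_game set \<Rightarrow> ereal" where
  "class_price_of_stability C = Sup {r. \<exists>G\<in>C. has_price_of_stability G r}"

end

theory Submission imports Defs begin

text \<open>Both endpoints of an edge receive the same reward, and a player influences only incident edges,
  so a unilateral deviation changes the welfare by twice the change in the deviator's utility.
  Hence a social optimum, which exists by compactness, is a Nash equilibrium.  A bilateral deviation
  of \<open>u\<close> and \<open>v\<close> interacts only on the edge \<open>{u, v}\<close>, where just the larger contribution counts;
  its contributor does at least as well by performing the own part of the deviation alone.  So every
  Nash equilibrium is a pairwise equilibrium.\<close>

section \<open>Compactness of the state space and existence of a social optimum\<close>

lemma compact_PiE:
  fixes S :: "'i \<Rightarrow> 'a::topological_space set"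
  assumes "\<And>i. i \<in> I \<Longrightarrow> compact (S i)"
  shows "compact (Pi\<^sub>E I S)"
proof -
  \<comment> \<open>Functions carry the product topology over the whole index type, so the set is
    rewritten as a product over \<open>UNIV\<close>; extensionality outside \<open>I\<close> becomes
    the compact factor \<open>{undefined}\<close>.\<close>
  define T where "T i = (if i \<in> I then S i else {undefined})" for i
  have "Pi\<^sub>E I S = Pi\<^sub>E UNIV T"
    by (force simp: T_def PiE_iff extensional_def split: if_splits)
  moreover have "compactin (product_topology (\<lambda>_. euclidean) UNIV) (Pi\<^sub>E UNIV T)"
    using assms by (auto simp: compactin_PiE T_def)
  ultimately show ?thesis
    by (simp add: euclidean_product_topology)
qed

lemma network_contribution_gameD:
  assumes "network_contribution_game G"
  shows "finite (players G)" "finite (edges G)" "v \<in> players G \<Longrightarrow> 0 \<le> budget G v"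
    and "{u, v} \<in> edges G \<Longrightarrow> u \<in> players G \<and> v \<in> players G \<and> u \<noteq> v"
    and "e \<in> edges G \<Longrightarrow> continuous_on ({0..} \<times> {0..}) (\<lambda>(x, y). reward G e x y)"
proof -
  show "finite (players G)" "v \<in> players G \<Longrightarrow> 0 \<le> budget G v"
    "e \<in> edges G \<Longrightarrow> continuous_on ({0..} \<times> {0..}) (\<lambda>(x, y). reward G e x y)"
    using assms by (auto simp: network_contribution_game_def)
  have sub: "edges G \<subseteq> {e. e \<subseteq> players G \<and> card e = 2}"
    using assms by (simp add: network_contribution_game_def)
  then show "finite (edges G)"
    using \<open>finite (players G)\<close> by - (rule finite_subset[of _ "Pow (players G)"], auto)
  show "u \<in> players G \<and> v \<in> players G \<and> u \<noteq> v" if "{u, v} \<in> edges G"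
    using sub that by (auto simp: card_insert_if split: if_splits)
qed

lemma strategies_nonneg:
  "x \<in> strategies G v \<Longrightarrow> e \<in> edges G \<Longrightarrow> v \<in> e \<Longrightarrow> 0 \<le> x e"
  by (auto simp: strategies_def incident_edges_def PiE_iff)

lemma states_nonneg:
  "s \<in> states G \<Longrightarrow> v \<in> players G \<Longrightarrow> e \<in> edges G \<Longrightarrow> v \<in> e \<Longrightarrow> 0 \<le> s v e"
  by (auto simp: states_def PiE_iff intro: strategies_nonneg)

lemma states_fun_upd:
  "s \<in> states G \<Longrightarrow> v \<in> players G \<Longrightarrow> x \<in> strategies G v \<Longrightarrow> s(v := x) \<in> states G"
  by (auto simp: states_def PiE_iff extensional_def)

text \<open>The factors \<open>{0..}\<close> are unbounded, but nonnegativity and the budget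
  together bound every coordinate by the budget. What remains is a compact box cut by a closed
  half-space.\<close>

lemma compact_strategies:
  assumes "finite (edges G)"
  shows "compact (strategies G v)"
proof -
  let ?I = "incident_edges G v"
  have fin: "finite ?I" using assms by (simp add: incident_edges_def)
  have bound: "x e \<le> budget G v"
    if "x \<in> ?I \<rightarrow>\<^sub>E {0..}" "(\<Sum>e\<in>?I. x e) \<le> budget G v" "e \<in> ?I" for x e
  proof -
    have "x e \<le> (\<Sum>e\<in>?I. x e)"
      using that(1) by (intro member_le_sum[OF that(3) _ fin]) (simp add: PiE_iff)
    with that(2) show ?thesis by linarith
  qed
  have "strategies G v = (?I \<rightarrow>\<^sub>E {0..budget G v}) \<inter> {x. (\<Sum>e\<in>?I. x e) \<le> budget G v}"
  proof (intro equalityI subsetI)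
    fix x assume "x \<in> strategies G v"
    then have x: "x \<in> ?I \<rightarrow>\<^sub>E {0..}" "(\<Sum>e\<in>?I. x e) \<le> budget G v"
      by (simp_all add: strategies_def)
    then show "x \<in> (?I \<rightarrow>\<^sub>E {0..budget G v}) \<inter> {x. (\<Sum>e\<in>?I. x e) \<le> budget G v}"
      using bound[OF x] by (simp add: PiE_iff)
  qed (simp add: strategies_def PiE_iff)
  moreover have "closed {x :: 'a set \<Rightarrow> real. (\<Sum>e\<in>?I. x e) \<le> budget G v}"
    by (intro closed_Collect_le continuous_intros continuous_on_product_coordinates)
  ultimately show ?thesis
    by (simp add: compact_Int_closed compact_PiE)
qed

lemma strategies_nonempty:
  assumes "0 \<le> budget G v"
  shows "strategies G v \<noteq> {}"
proof -
  have "(\<lambda>e\<in>incident_edges G v. 0) \<in> strategies G v"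
    using assms by (simp add: strategies_def)
  then show ?thesis by blast
qed

lemma continuous_on_welfare:
  assumes "network_contribution_game G"
  shows "continuous_on (states G) (welfare G)"
  unfolding welfare_def utility_def
proof (intro continuous_on_sum)
  fix v u assume "u \<in> {u. {v, u} \<in> edges G}"
  then have e: "{v, u} \<in> edges G" by simp
  have "continuous_on (states G) (\<lambda>s. s w {v, u})" for w
    by (intro continuous_on_product_then_coordinatewise[of _ "\<lambda>s. s w"]
          continuous_on_product_then_coordinatewise[of _ "\<lambda>s. s"] continuous_intros)
  then have "continuous_on (states G) (\<lambda>s. (s v {v, u}, s u {v, u}))"
    by (intro continuous_intros)
  \<comment> \<open>Rewards are assumed continuous only on the nonnegative quadrant, so composition
    requires the contributions to lie there.\<close>
  moreover have "(\<lambda>s. (s v {v, u}, s u {v, u})) ` states G \<subseteq> {0..} \<times> {0..}"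
    using network_contribution_gameD(4)[OF assms e] e by (auto intro: states_nonneg)
  ultimately have "continuous_on (states G)
      (\<lambda>s. (\<lambda>(x, y). reward G {v, u} x y) (s v {v, u}, s u {v, u}))"
    using network_contribution_gameD(5)[OF assms e] by (rule continuous_on_compose2[rotated])
  then show "continuous_on (states G) (\<lambda>s. reward G {v, u} (s v {v, u}) (s u {v, u}))"
    by simp
qed

lemma social_optimum_exists:
  assumes "network_contribution_game G"
  obtains s where "social_optimum G s"
proof -
  have "compact (states G)"
    unfolding states_def
    by (intro compact_PiE compact_strategies network_contribution_gameD(2)[OF assms])
  moreover have "states G \<noteq> {}"
    using network_contribution_gameD(3)[OF assms] strategies_nonempty
    by (force simp: states_def PiE_eq_empty_iff)
  ultimately show ?thesis
    using continuous_attains_sup[OF _ _ continuous_on_welfare[OF assms]] that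
    by (auto simp: social_optimum_def)
qed

section \<open>Welfare change under a unilateral deviation\<close>

text \<open>A symmetric matrix supported on the row and column of \<open>v\<close>, with zero at
  their crossing: row and column have the same sum and share no nonzero entry.\<close>

lemma sum_row_column:
  fixes D :: "'a \<Rightarrow> 'a \<Rightarrow> real"
  assumes "finite A" "v \<in> A"
    and sym: "\<And>p q. p \<in> A \<Longrightarrow> q \<in> A \<Longrightarrow> D p q = D q p"
    and zero: "\<And>p q. p \<noteq> v \<Longrightarrow> q \<noteq> v \<Longrightarrow> D p q = 0" and "D v v = 0"
  shows "(\<Sum>p\<in>A. \<Sum>q\<in>A. D p q) = 2 * (\<Sum>q\<in>A. D v q)"
proof -
  \<comment> \<open>In a row other than that of \<open>v\<close> only the entry in column
    \<open>v\<close> survives; symmetry moves it to row \<open>v\<close>.\<close>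
  have "(\<Sum>q\<in>A. D p q) = D v p" if "p \<in> A - {v}" for p
  proof -
    have "(\<Sum>q\<in>A. D p q) = D p v + (\<Sum>q\<in>A - {v}. D p q)"
      using assms(1,2) by (rule sum.remove)
    also have "(\<Sum>q\<in>A - {v}. D p q) = 0"
      using that zero by (intro sum.neutral) auto
    finally show ?thesis using that sym assms(2) by simp
  qed
  then have "(\<Sum>p\<in>A - {v}. \<Sum>q\<in>A. D p q) = (\<Sum>p\<in>A - {v}. D v p)"
    by (intro sum.cong) auto
  also have "\<dots> = (\<Sum>p\<in>A. D v p)"
    using assms(1,2,5) by (simp add: sum.remove[of A v])
  finally show ?thesis
    using assms(1,2) by (simp add: sum.remove[of A v "\<lambda>p. \<Sum>q\<in>A. D p q"])
qed

text \<open>Extending the reward by zero to all ordered pairs turns the welfare into the sum of a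
  square matrix indexed by the players.\<close>

definition link_reward ::
  "'v contribution_game \<Rightarrow> ('v \<Rightarrow> 'v set \<Rightarrow> real) \<Rightarrow> 'v \<Rightarrow> 'v \<Rightarrow> real" where
  "link_reward G s u v =
     (if {u, v} \<in> edges G then reward G {u, v} (s u {u, v}) (s v {u, v}) else 0)"

lemma utility_eq_sum_link_reward:
  assumes "network_contribution_game G"
  shows "utility G s v = (\<Sum>u\<in>players G. link_reward G s v u)"
  unfolding utility_def link_reward_def
  using network_contribution_gameD(1,4)[OF assms]
  by (intro sum.mono_neutral_cong_left) auto

lemma max_effort_game_network: "max_effort_game G \<Longrightarrow> network_contribution_game G"
  by (simp add: max_effort_game_def)

lemma max_effort_reward_commute:
  assumes "max_effort_game G" "e \<in> edges G" "0 \<le> x" "0 \<le> y"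
  shows "reward G e x y = reward G e y x"
  using assms by (auto simp: max_effort_game_def max.commute)

text \<open>Comparing maxima rather than coordinates permits one contribution to drop, as long as
  the larger one does not suffer.\<close>

lemma max_effort_reward_mono:
  assumes "max_effort_game G" "e \<in> edges G" "0 \<le> x" "0 \<le> y" "0 \<le> x'" "0 \<le> y'"
    and "max x y \<le> max x' y'"
  shows "reward G e x y \<le> reward G e x' y'"
proof -
  obtain h where "mono_on {0..} (h e)" "\<forall>x\<ge>0. \<forall>y\<ge>0. reward G e x y = h e (max x y)"
    using assms(1,2) by (auto simp: max_effort_game_def)
  moreover have "max x y \<in> {0..}" "max x' y' \<in> {0..}"
    using assms(3-6) by auto
  ultimately show ?thesis
    using assms(3-7) by (simp add: mono_onD)
qed

lemma link_reward_commute: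
  assumes "max_effort_game G" "s \<in> states G"
  shows "link_reward G s u v = link_reward G s v u"
proof (cases "{u, v} \<in> edges G")
  case True
  then have "u \<in> players G" "v \<in> players G"
    using network_contribution_gameD(4)[OF max_effort_game_network[OF assms(1)]] by auto
  then have "reward G {u, v} (s u {u, v}) (s v {u, v}) =
      reward G {u, v} (s v {u, v}) (s u {u, v})"
    using True assms by (intro max_effort_reward_commute) (auto intro: states_nonneg)
  then show ?thesis by (simp add: link_reward_def insert_commute)
qed (simp add: link_reward_def insert_commute)

text \<open>Half the welfare is thus an exact potential. The matrix of link reward changes is
  symmetric, vanishes away from \<open>v\<close>, and has zero at \<open>(v, v)\<close> because the
  graph has no loops.\<close>

lemma welfare_deviation:
  assumes G: "max_effort_game G" and "s \<in> states G" "v \<in> players G" "x \<in> strategies G v"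
  shows "welfare G (s(v := x)) - welfare G s = 2 * (utility G (s(v := x)) v - utility G s v)"
proof -
  note net = max_effort_game_network[OF G]
  define D where "D p q = link_reward G (s(v := x)) p q - link_reward G s p q" for p q
  have "D v v = 0"
    using network_contribution_gameD(4)[OF net, of v v] by (auto simp: D_def link_reward_def)
  moreover have "D p q = D q p" for p q
    using link_reward_commute[OF G, of s p q]
      link_reward_commute[OF G states_fun_upd[OF assms(2-4)], of p q] assms(2)
    by (simp add: D_def)
  moreover have "D p q = 0" if "p \<noteq> v" "q \<noteq> v" for p q
    using that by (simp add: D_def link_reward_def)
  ultimately have "(\<Sum>p\<in>players G. \<Sum>q\<in>players G. D p q) = 2 * (\<Sum>q\<in>players G. D v q)"
    using sum_row_column[OF network_contribution_gameD(1)[OF net] assms(3), of D] by blast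
  then show ?thesis
    by (simp add: D_def welfare_def utility_eq_sum_link_reward[OF net] sum_subtractf)
qed

section \<open>From social optimum to pairwise equilibrium\<close>

lemma social_optimum_imp_nash:
  assumes "max_effort_game G" "social_optimum G s"
  shows "nash_equilibrium G s"
  unfolding nash_equilibrium_def
proof (intro conjI ballI)
  show s: "s \<in> states G" using assms(2) by (simp add: social_optimum_def)
  fix v x assume v: "v \<in> players G" "x \<in> strategies G v"
  then have "welfare G (s(v := x)) \<le> welfare G s"
    using assms(2) s by (auto simp: social_optimum_def states_fun_upd)
  then show "utility G (s(v := x)) v \<le> utility G s v"
    using welfare_deviation[OF assms(1) s v] by simp
qed

lemma bilateral_le_unilateral:
  assumes G: "max_effort_game G" and s: "s \<in> states G"
    and uv: "u \<in> players G" "v \<in> players G" "u \<noteq> v"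
    and xy: "x \<in> strategies G u" "y \<in> strategies G v" "{u, v} \<in> edges G \<Longrightarrow> y {u, v} \<le> x {u, v}"
  shows "utility G (s(u := x, v := y)) u \<le> utility G (s(u := x)) u"
  unfolding utility_eq_sum_link_reward[OF max_effort_game_network[OF G]]
proof (rule sum_mono)
  fix q assume "q \<in> players G"
  show "link_reward G (s(u := x, v := y)) u q \<le> link_reward G (s(u := x)) u q"
  \<comment> \<open>The strategy of \<open>v\<close> enters the utility of \<open>u\<close> only
    through the shared edge; all other terms agree.\<close>
  proof (cases "q = v \<and> {u, v} \<in> edges G")
    case True
    then have e: "{u, v} \<in> edges G" by simp
    have "0 \<le> x {u, v}" "0 \<le> y {u, v}" "0 \<le> s v {u, v}"
      using strategies_nonneg[OF xy(1) e] strategies_nonneg[OF xy(2) e]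
        states_nonneg[OF s uv(2) e] by simp_all
    \<comment> \<open>The maximum on the left is \<open>x {u, v}\<close>, which stays available when
      \<open>y\<close> is replaced by the old contribution of \<open>v\<close>.\<close>
    then have "reward G {u, v} (x {u, v}) (y {u, v}) \<le> reward G {u, v} (x {u, v}) (s v {u, v})"
      using xy(3)[OF e] by (intro max_effort_reward_mono[OF G e]) simp_all
    then show ?thesis using True uv by (simp add: link_reward_def)
  qed (use uv in \<open>auto simp: link_reward_def\<close>)
qed

lemma nash_imp_pairwise:
  assumes G: "max_effort_game G" and nash: "nash_equilibrium G s"
  shows "pairwise_equilibrium G s"
proof -
  have s: "s \<in> states G" using nash by (simp add: nash_equilibrium_def)
  have False if dev: "improving_bilateral_deviation G s u v x y" for u v x y
  proof -
    have uv: "u \<in> players G" "v \<in> players G" "u \<noteq> v"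
      and xy: "x \<in> strategies G u" "y \<in> strategies G v"
      and u: "utility G s u < utility G (s(u := x, v := y)) u"
      and v: "utility G s v < utility G (s(u := x, v := y)) v"
      using dev by (simp_all add: improving_bilateral_deviation_def)
    have unilateral: "utility G (s(p := z)) p \<le> utility G s p"
      if "p \<in> players G" "z \<in> strategies G p" for p z
      using nash that unfolding nash_equilibrium_def by blast
    show False
    \<comment> \<open>If \<open>{u, v}\<close> is not an edge, both values are
      \<open>undefined\<close> and the first case applies.\<close>
    proof (cases "y {u, v} \<le> x {u, v}")
      case True
      have "utility G (s(u := x, v := y)) u \<le> utility G (s(u := x)) u"
        using uv xy True by (rule bilateral_le_unilateral[OF G s])
      with unilateral[OF uv(1) xy(1)] u show False by linarith
    next
      case False
      \<comment> \<open>Same argument with the players exchanged; the two updates commute since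
        \<open>u \<noteq> v\<close>.\<close>
      then have "x {v, u} \<le> y {v, u}" by (simp add: insert_commute[of v u])
      with uv(2,1) uv(3)[symmetric] xy(2,1)
      have "utility G (s(v := y, u := x)) v \<le> utility G (s(v := y)) v"
        by (rule bilateral_le_unilateral[OF G s])
      with unilateral[OF uv(2) xy(2)] v fun_upd_twist[OF uv(3), of s x y] show False by simp
    qed
  qed
  then show ?thesis using nash unfolding pairwise_equilibrium_def by blast
qed

section \<open>The price of stability\<close>

lemma pairwise_equilibrium_states: "pairwise_equilibrium G s \<Longrightarrow> s \<in> states G"
  unfolding pairwise_equilibrium_def nash_equilibrium_def by (elim conjE)

lemma social_optimum_imp_best_pairwise:
  assumes "max_effort_game G" "social_optimum G s"
  shows "best_pairwise_equilibrium G s"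
  unfolding best_pairwise_equilibrium_def
proof (intro conjI allI impI)
  show "pairwise_equilibrium G s"
    using assms by (intro nash_imp_pairwise social_optimum_imp_nash)
  fix t assume "pairwise_equilibrium G t"
  then show "welfare G t \<le> welfare G s"
    using assms(2) pairwise_equilibrium_states unfolding social_optimum_def by blast
qed

text \<open>An optimum is itself a best pairwise equilibrium, so every best one attains the optimal
  welfare, whichever witnesses are chosen.\<close>

lemma has_price_of_stability_iff:
  assumes G: "max_effort_game G"
  shows "has_price_of_stability G r \<longleftrightarrow> r = 1"
proof -
  have ratio: "welfare_ratio (welfare G t) (welfare G s) = 1"
    if t: "social_optimum G t" and s: "best_pairwise_equilibrium G s" for t s
  proof -
    have "pairwise_equilibrium G s" "pairwise_equilibrium G t"
      using s social_optimum_imp_best_pairwise[OF G t]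
      by (simp_all only: best_pairwise_equilibrium_def)
    then have "welfare G s = welfare G t"
      using s social_optimum_imp_best_pairwise[OF G t]
      unfolding best_pairwise_equilibrium_def by (blast intro: antisym)
    \<comment> \<open>If both welfares are 0, the convention for \<open>0 / 0\<close> yields
      1.\<close>
    then show ?thesis by (simp add: welfare_ratio_def)
  qed
  obtain s where "social_optimum G s"
    using social_optimum_exists[OF max_effort_game_network[OF G]] .
  then have "\<exists>t s. social_optimum G t \<and> best_pairwise_equilibrium G s"
    using social_optimum_imp_best_pairwise[OF G] by blast
  then show ?thesis
    unfolding has_price_of_stability_def using ratio by (auto; metis)
qed

text \<open>Ensures that the class is inhabited for every vertex type: the supremum of an empty set
  of ratios would be -\<infinity> instead of 1.\<close>

lemma max_effort_game_empty:
  "max_effort_game \<lparr>players = {}, edges = {}, budget = b, reward = f\<rparr>"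
  by (simp add: max_effort_game_def network_contribution_game_def)

theorem theorem5p2:
  "(\<forall>G :: 'v contribution_game. max_effort_game G \<longrightarrow> (\<exists>s. pairwise_equilibrium G s)) \<and>
   (\<forall>G :: 'v contribution_game. max_effort_game G \<longrightarrow> (\<exists>r. has_price_of_stability G r)) \<and>
   class_price_of_stability {G :: 'v contribution_game. max_effort_game G} = 1"
proof (intro conjI allI impI)
  fix G :: "'v contribution_game" assume G: "max_effort_game G"
  then show "\<exists>r. has_price_of_stability G r" by (simp add: has_price_of_stability_iff)
  then show "\<exists>s. pairwise_equilibrium G s"
    unfolding has_price_of_stability_def best_pairwise_equilibrium_def by blast
next
  have "{r. \<exists>G \<in> {G :: 'v contribution_game. max_effort_game G}. has_price_of_stability G r} = {1}"
    using max_effort_game_empty by (auto simp: has_price_of_stability_iff)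
  then show "class_price_of_stability {G :: 'v contribution_game. max_effort_game G} = 1"
    by (simp add: class_price_of_stability_def)
qed

end
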